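(* Let $\mathcal{H}$ be a complex Hilbert space and let $T\in\mathcal{B}(\mathcal{H})$. Then $$dw^2(T)\leq \sup_{\theta\in\mathbb{R}} w^2\left(e^{\mathrm{i}\theta}T+T^*T\right)-2\,c(T)\,m^2(T).$$
   Context: $\mathcal{B}(\mathcal{H})$ is the algebra of bounded linear operators on the complex Hilbert space $\mathcal{H}$. For $T\in\mathcal{B}(\mathcal{H})$: the numerical radius is $w(T)=\sup\{|\langle Tx,x\rangle|: \|x\|=1\}$; the Crawford number is $c(T)=\inf\{|\langle Tx,x\rangle|: \|x\|=1\}$; the minimum norm is $m(T)=\inf\{\|Tx\|: \|x\|=1\}$; the Davis-Wielandt radius is $dw(T)=\sup\{\sqrt{|\langle Tx,x\rangle|^2+\|Tx\|^4}: \|x\|=1\}$, with $x$ ranging over unit vectors of $\mathcal{H}$. Powers such as $dw^2(T)$ mean $(dw(T))^2$, and similarly for $w^2$, $m^2$. *)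

theory Defs
  imports "HOL-Analysis.Analysis"
begin

class scaleC = scaleR +
  fixes scaleC :: "complex \<Rightarrow> 'a \<Rightarrow> 'a"  (infixr "*\<^sub>C" 75)
  assumes scaleR_scaleC: "r *\<^sub>R x = complex_of_real r *\<^sub>C x"

class complex_vector = scaleC + real_vector +
  assumes scaleC_add_right: "a *\<^sub>C (x + y) = a *\<^sub>C x + a *\<^sub>C y"
    and scaleC_add_left: "(a + b) *\<^sub>C x = a *\<^sub>C x + b *\<^sub>C x"
    and scaleC_scaleC: "a *\<^sub>C (b *\<^sub>C x) = (a * b) *\<^sub>C x"
    and scaleC_one: "1 *\<^sub>C x = x"

text \<open>The inner product is linear in its first argument and conjugate-linear in its second.\<close>

class complex_inner = complex_vector + real_normed_vector +
  fixes cinner :: "'a \<Rightarrow> 'a \<Rightarrow> complex"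
  assumes cinner_commute: "cinner x y = cnj (cinner y x)"
    and cinner_add_left: "cinner (x + y) z = cinner x z + cinner y z"
    and cinner_scaleC_left: "cinner (a *\<^sub>C x) y = a * cinner x y"
    and cinner_ge_zero: "0 \<le> Re (cinner x x)"
    and cinner_eq_zero_iff: "cinner x x = 0 \<longleftrightarrow> x = 0"
    and norm_eq_sqrt_cinner: "norm x = sqrt (Re (cinner x x))"

class chilbert_space = complex_inner + complete_space

instantiation complex :: chilbert_space
begin

definition scaleC_complex :: "complex \<Rightarrow> complex \<Rightarrow> complex"
  where "scaleC_complex a x = a * x"

definition cinner_complex :: "complex \<Rightarrow> complex \<Rightarrow> complex"
  where "cinner_complex x y = x * cnj y"

instance
proof
  fix x y z a b :: complex and r :: real
  show "r *\<^sub>R x = complex_of_real r *\<^sub>C x"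
    by (simp add: scaleC_complex_def scaleR_conv_of_real)
  show "norm x = sqrt (Re (cinner x x))"
    by (simp add: cinner_complex_def cmod_def power2_eq_square)
qed (auto simp: scaleC_complex_def cinner_complex_def algebra_simps)

end

definition bounded_clinear :: "('a::complex_inner \<Rightarrow> 'b::complex_inner) \<Rightarrow> bool"
  where "bounded_clinear T \<longleftrightarrow> bounded_linear T \<and> (\<forall>a x. T (a *\<^sub>C x) = a *\<^sub>C T x)"

text \<open>For a bounded operator on a Hilbert space the function described here exists (Riesz) and is
  unique; it is then itself bounded and linear.\<close>

definition cadjoint :: "('a::chilbert_space \<Rightarrow> 'b::chilbert_space) \<Rightarrow> 'b \<Rightarrow> 'a"
  where "cadjoint T = (THE S. \<forall>x y. cinner (T x) y = cinner x (S y))"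

text \<open>The suprema and infima below are taken in the reals. They have their intended meaning for
  bounded operators on a nonzero space; on the zero space there is no unit vector, and the supremum
  and infimum of the empty set of reals are unspecified.\<close>

definition numerical_radius :: "('a::complex_inner \<Rightarrow> 'a) \<Rightarrow> real"
  where "numerical_radius T = (SUP x\<in>{x. norm x = 1}. cmod (cinner (T x) x))"

definition crawford_number :: "('a::complex_inner \<Rightarrow> 'a) \<Rightarrow> real"
  where "crawford_number T = (INF x\<in>{x. norm x = 1}. cmod (cinner (T x) x))"

definition minimum_norm :: "('a::complex_inner \<Rightarrow> 'a) \<Rightarrow> real"
  where "minimum_norm T = (INF x\<in>{x. norm x = 1}. norm (T x))"

definition davis_wielandt_radius :: "('a::complex_inner \<Rightarrow> 'a) \<Rightarrow> real"
  where "davis_wielandt_radius T =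
    (SUP x\<in>{x. norm x = 1}. sqrt ((cmod (cinner (T x) x))\<^sup>2 + norm (T x) ^ 4))"

end

theory Submission
  imports Defs
begin

text \<open>For a unit vector \<open>x\<close>, rotate so that \<open>exp (\<i> * \<theta>) * cinner (T x) x\<close> becomes
  \<open>a = cmod (cinner (T x) x)\<close>. With \<open>b = (norm (T x))\<^sup>2 = cinner (cadjoint T (T x)) x\<close> the rotated
  operator has the value \<open>a + b\<close> at \<open>x\<close>, and \<open>(a + b)\<^sup>2 - 2 * a * b = a\<^sup>2 + b\<^sup>2\<close> is the quantity whose
  supremum is the squared Davis-Wielandt radius; finally \<open>a * b\<close> is at least the Crawford number
  times the squared minimum norm. Existence of the adjoint comes from the Riesz representation
  theorem, where the representing vector minimizes \<open>(norm x)\<^sup>2 - 2 * Re (f x)\<close>.\<close>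

section \<open>Inner product algebra and norm identities\<close>

lemma cinner_add_right: "cinner x (y + z) = cinner x y + cinner x (z::'a::complex_inner)"
  by (metis cinner_add_left cinner_commute complex_cnj_add)

lemma cinner_scaleC_right: "cinner x (a *\<^sub>C y) = cnj a * cinner x (y::'a::complex_inner)"
  by (metis cinner_scaleC_left cinner_commute complex_cnj_mult)

lemma cinner_scaleR_left: "cinner (r *\<^sub>R x) y = complex_of_real r * cinner x (y::'a::complex_inner)"
  by (simp add: scaleR_scaleC cinner_scaleC_left)

lemma cinner_scaleR_right: "cinner x (r *\<^sub>R y) = complex_of_real r * cinner x (y::'a::complex_inner)"
  by (simp add: scaleR_scaleC cinner_scaleC_right)

lemma cinner_minus_right: "cinner x (- y) = - cinner x (y::'a::complex_inner)"
  using cinner_scaleR_right[of x "-1" y] by simp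

lemma cinner_diff_right: "cinner x (y - z) = cinner x y - cinner x (z::'a::complex_inner)"
  using cinner_add_right[of x y "- z"] by (simp add: cinner_minus_right)

lemma cinner_self: "cinner x x = complex_of_real ((norm (x::'a::complex_inner))\<^sup>2)"
proof -
  have "Im (cinner x x) = 0"
    using arg_cong[OF cinner_commute[of x x], of Im] by simp
  moreover have "Re (cinner x x) = (norm x)\<^sup>2"
    by (simp add: norm_eq_sqrt_cinner cinner_ge_zero)
  ultimately show ?thesis
    by (simp add: complex_eq_iff)
qed

lemma norm_scaleC: "norm (a *\<^sub>C x) = cmod a * norm (x::'a::complex_inner)"
proof -
  have "complex_of_real ((norm (a *\<^sub>C x))\<^sup>2) = (a * cnj a) * cinner x x"
    unfolding cinner_self[symmetric] cinner_scaleC_left cinner_scaleC_right by (simp only: mult_ac)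
  also have "\<dots> = complex_of_real ((cmod a * norm x)\<^sup>2)"
    by (simp only: cinner_self complex_norm_square[symmetric] of_real_mult[symmetric] power_mult_distrib)
  finally have "(norm (a *\<^sub>C x))\<^sup>2 = (cmod a * norm x)\<^sup>2"
    by (simp only: of_real_eq_iff)
  then show ?thesis
    by simp
qed

lemma power2_norm_add:
  "(norm (x + y))\<^sup>2 = (norm x)\<^sup>2 + 2 * Re (cinner x y) + (norm (y::'a::complex_inner))\<^sup>2"
proof -
  have "Re (cinner (x + y) (x + y)) =
      Re (cinner x x) + Re (cinner x y) + Re (cinner y x) + Re (cinner y y)"
    by (simp add: cinner_add_left cinner_add_right)
  moreover have "Re (cinner y x) = Re (cinner x y)"
    using cinner_commute[of y x] by simp
  ultimately show ?thesis
    by (simp add: cinner_self)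
qed

lemma parallelogram:
  "(norm (x + y))\<^sup>2 + (norm (x - y))\<^sup>2 = 2 * (norm x)\<^sup>2 + 2 * (norm (y::'a::complex_inner))\<^sup>2"
  using power2_norm_add[of x y] power2_norm_add[of x "- y"] by (simp add: cinner_minus_right)

section \<open>Rotation to the real axis and Cauchy-Schwarz\<close>

lemma rotate_to_cmod: "\<exists>\<theta>. exp (\<i> * complex_of_real \<theta>) * z = complex_of_real (cmod z)"
proof
  have "z = complex_of_real (cmod z) * exp (\<i> * complex_of_real (Arg z))"
    by (cases "z = 0") (simp_all add: Arg_eq[symmetric])
  then have "exp (\<i> * complex_of_real (- Arg z)) * z = complex_of_real (cmod z) *
      (exp (\<i> * complex_of_real (- Arg z)) * exp (\<i> * complex_of_real (Arg z)))"
    by (metis mult.left_commute)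
  then show "exp (\<i> * complex_of_real (- Arg z)) * z = complex_of_real (cmod z)"
    by (simp flip: exp_add)
qed

text \<open>The triangle inequality already holds in the normed space; expanding both of its squared
  sides leaves twice this bound.\<close>

lemma Re_cinner_le: "Re (cinner x y) \<le> norm x * norm (y::'a::complex_inner)"
proof -
  have "(norm (x + y))\<^sup>2 \<le> (norm x + norm y)\<^sup>2"
    by (intro power_mono norm_triangle_ineq) simp
  then show ?thesis
    by (simp add: power2_norm_add power2_sum)
qed

text \<open>A unimodular factor on \<open>x\<close> makes the inner product real and nonnegative
  without changing \<open>norm x\<close>, which reduces the claim to
  \<open>Re_cinner_le\<close>.\<close>

lemma complex_Cauchy_Schwarz: "cmod (cinner x y) \<le> norm x * norm (y::'a::complex_inner)"
proof -
  obtain \<theta> where "exp (\<i> * complex_of_real \<theta>) * cinner x y = complex_of_real (cmod (cinner x y))"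
    using rotate_to_cmod by blast
  then have "cmod (cinner x y) = Re (cinner (exp (\<i> * complex_of_real \<theta>) *\<^sub>C x) y)"
    by (simp add: cinner_scaleC_left)
  also have "\<dots> \<le> norm x * norm y"
    using Re_cinner_le[of "exp (\<i> * complex_of_real \<theta>) *\<^sub>C x" y] by (simp add: norm_scaleC)
  finally show ?thesis .
qed

section \<open>Riesz representation by minimization\<close>

lemma real_quadratic_nonneg_imp_zero:
  fixes b c :: real
  assumes "\<And>t. 0 \<le> 2 * t * b + t\<^sup>2 * c"
  shows "b = 0"
proof (rule ccontr)
  assume "b \<noteq> 0"
  \<comment> \<open>Adding the instances t = 1 and t = -1 cancels the linear term.\<close>
  have "0 \<le> c"
    using assms[of 1] assms[of "-1"] by simp
  then have c: "c + 1 > 0" by simp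
  \<comment> \<open>The quadratic is minimal at -b / c; the denominator c + 1 also covers c = 0 and
    still gives a negative value.\<close>
  define t where "t = - b / (c + 1)"
  have b: "b = - t * (c + 1)"
    using c by (simp add: t_def)
  have "2 * t * b + t\<^sup>2 * c = - (t\<^sup>2 * (c + 2))"
    unfolding b by (simp add: power2_eq_square algebra_simps)
  moreover have "t\<^sup>2 * (c + 2) > 0"
    using \<open>b \<noteq> 0\<close> \<open>0 \<le> c\<close> c by (auto simp: t_def)
  ultimately show False
    using assms[of t] by simp
qed

text \<open>If \<open>z\<close> represents \<open>g\<close>, then \<open>J x\<close> below equals
  \<open>(norm (x - z))\<^sup>2 - (norm z)\<^sup>2\<close>, so \<open>z\<close> has to be the
  minimizer of \<open>J\<close>. Completeness provides a minimizer, and the vanishing first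
  variation there is the representation.\<close>

lemma bounded_linear_real_Riesz:
  fixes g :: "'a::chilbert_space \<Rightarrow> real"
  assumes "bounded_linear g"
  shows "\<exists>z. \<forall>x. g x = Re (cinner x z)"
proof -
  interpret g: bounded_linear g by fact
  define J where "J x = (norm x)\<^sup>2 - 2 * g x" for x
  obtain K where K: "\<And>x. norm (g x) \<le> norm x * K"
    using g.bounded by blast
  \<comment> \<open>Completing the square: \<open>J x\<close> is at least
    \<open>(norm x - K)\<^sup>2 - K\<^sup>2\<close>.\<close>
  have "- K\<^sup>2 \<le> J x" for x
  proof -
    have "g x \<le> norm x * K"
      using K[of x] by simp
    then show ?thesis
      using zero_le_power2[of "norm x - K"] by (simp add: J_def power2_diff)
  qed
  then have bdd: "bdd_below (range J)"
    by (auto intro!: bdd_belowI)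
  define d where "d = (INF x. J x)"
  have d_le: "d \<le> J x" for x
    unfolding d_def by (rule cINF_lower[OF bdd]) simp
  have "\<exists>x. J x < d + 1 / Suc n" for n
    using cINF_less_iff[OF _ bdd, of "d + 1 / Suc n"] by (simp add: d_def)
  then obtain X where X: "\<And>n. J (X n) < d + 1 / Suc n"
    by metis
  \<comment> \<open>By the parallelogram law the left side is 2 J x + 2 J y minus four times
    \<open>J\<close> at the midpoint, and that value is at least \<open>d\<close>.\<close>
  have gap: "(norm (x - y))\<^sup>2 \<le> 2 * (J x - d) + 2 * (J y - d)" for x y
  proof -
    have "4 * J ((1/2) *\<^sub>R (x + y)) = (norm (x + y))\<^sup>2 - 4 * (g x + g y)"
      by (simp add: J_def g.scaleR g.add power_divide add_divide_distrib)
    then show ?thesis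
      using parallelogram[of x y] d_le[of "(1/2) *\<^sub>R (x + y)"] by (simp add: J_def)
  qed
  have "Cauchy X"
  proof (rule metric_CauchyI)
    fix e :: real assume "e > 0"
    \<comment> \<open>Two excesses below \<open>e\<^sup>2 / 4\<close>, each doubled in
      \<open>gap\<close>, add up to less than \<open>e\<^sup>2\<close>.\<close>
    then obtain N where N: "inverse (Suc N) < e\<^sup>2 / 4"
      using reals_Archimedean[of "e\<^sup>2 / 4"] by auto
    have tail: "J (X n) - d < e\<^sup>2 / 4" if "n \<ge> N" for n
    proof -
      have "1 / real (Suc n) \<le> inverse (Suc N)"
        using that by (simp add: field_simps)
      then show ?thesis
        using X[of n] N by linarith
    qed
    have "dist (X m) (X n) < e" if "m \<ge> N" "n \<ge> N" for m n
    proof -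
      have "(norm (X m - X n))\<^sup>2 < e\<^sup>2"
        using gap[of "X m" "X n"] tail[OF that(1)] tail[OF that(2)] by simp
      then show ?thesis
        using \<open>e > 0\<close> by (simp add: dist_norm power_less_imp_less_base)
    qed
    then show "\<exists>M. \<forall>m\<ge>M. \<forall>n\<ge>M. dist (X m) (X n) < e"
      by blast
  qed
  then obtain z where z: "X \<longlonglongrightarrow> z"
    by (meson Cauchy_convergent convergent_def)
  have "(\<lambda>n. J (X n)) \<longlonglongrightarrow> J z"
    unfolding J_def by (intro tendsto_intros z g.tendsto)
  moreover have "(\<lambda>n. d + 1 / Suc n) \<longlonglongrightarrow> d + 0"
    by (intro tendsto_intros LIMSEQ_Suc[OF lim_1_over_n])
  ultimately have "J z \<le> d"
    using X by (auto intro: LIMSEQ_le less_imp_le)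
  then have min: "J z \<le> J y" for y
    using d_le[of y] by simp
  \<comment> \<open>The quadratic in t is the increment of \<open>J\<close> from \<open>z\<close> to
    \<open>z + t *\<^sub>R x\<close>; minimality makes it nonnegative, so its linear coefficient
    vanishes.\<close>
  have "Re (cinner z x) - g x = 0" for x
  proof (rule real_quadratic_nonneg_imp_zero)
    show "0 \<le> 2 * t * (Re (cinner z x) - g x) + t\<^sup>2 * (norm x)\<^sup>2" for t
      using min[of "z + t *\<^sub>R x"]
      by (simp add: J_def power2_norm_add cinner_scaleR_right g.add g.scaleR
          power_mult_distrib algebra_simps)
  qed
  then have "g x = Re (cinner x z)" for x
    using cinner_commute[of x z] by simp
  then show ?thesis by blast
qed

text \<open>The real part determines a complex-linear functional, since Im (f x) is minus the real
  part of \<open>f (\<i> *\<^sub>C x)\<close>.\<close>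

lemma complex_Riesz:
  fixes f :: "'a::chilbert_space \<Rightarrow> complex"
  assumes f: "bounded_clinear f"
  shows "\<exists>z. \<forall>x. f x = cinner x z"
proof -
  have "bounded_linear (\<lambda>x. Re (f x))"
    using f bounded_linear_compose[OF bounded_linear_Re, of f] by (simp add: bounded_clinear_def)
  then obtain z where z: "\<And>x. Re (f x) = Re (cinner x z)"
    using bounded_linear_real_Riesz by blast
  have "Im (f x) = Im (cinner x z)" for x
  proof -
    have "f (\<i> *\<^sub>C x) = \<i> * f x"
      using f by (simp add: bounded_clinear_def scaleC_complex_def)
    then show ?thesis
      using z[of "\<i> *\<^sub>C x"] by (simp add: cinner_scaleC_left)
  qed
  with z show ?thesis
    by (metis complex_eq_iff)
qed

section \<open>The adjoint\<close>

lemma bounded_clinear_cinner: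
  fixes T :: "'a::complex_inner \<Rightarrow> 'b::complex_inner"
  assumes T: "bounded_clinear T"
  shows "bounded_clinear (\<lambda>x. cinner (T x) y)"
proof -
  interpret T: bounded_linear T
    using T by (simp add: bounded_clinear_def)
  obtain K where K: "\<And>x. norm (T x) \<le> norm x * K"
    using T.bounded by blast
  have "bounded_linear (\<lambda>x. cinner (T x) y)"
  proof (rule bounded_linear_intro)
    show "norm (cinner (T x) y) \<le> norm x * (K * norm y)" for x
      using complex_Cauchy_Schwarz[of "T x" y] mult_right_mono[OF K[of x] norm_ge_zero[of y]]
      by (simp add: mult.assoc)
  qed (auto simp: T.add T.scaleR cinner_add_left cinner_scaleR_left scaleR_conv_of_real)
  then show ?thesis
    using T by (simp add: bounded_clinear_def cinner_scaleC_left scaleC_complex_def)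
qed

text \<open>Test with x = u - v. This is the uniqueness behind the definite description in
  \<open>cadjoint\<close>.\<close>

lemma cinner_right_eqI:
  fixes u v :: "'a::complex_inner"
  assumes "\<And>x. cinner x u = cinner x v"
  shows "u = v"
proof -
  have "cinner (u - v) (u - v) = 0"
    by (simp add: cinner_diff_right assms)
  then show ?thesis
    by (simp add: cinner_eq_zero_iff)
qed

text \<open>Riesz, applied for each \<open>y\<close>, yields a function with the defining property
  of \<open>cadjoint\<close>; with uniqueness, the description denotes it.\<close>

lemma cinner_cadjoint:
  fixes T :: "'a::chilbert_space \<Rightarrow> 'b::chilbert_space"
  assumes "bounded_clinear T"
  shows "cinner (T x) y = cinner x (cadjoint T y)"
proof -
  have "\<exists>z. \<forall>x. cinner (T x) y = cinner x z" for y
    by (intro complex_Riesz bounded_clinear_cinner assms)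
  then obtain S where S: "\<forall>x y. cinner (T x) y = cinner x (S y)"
    by metis
  have "\<forall>x y. cinner (T x) y = cinner x (cadjoint T y)"
    unfolding cadjoint_def
  proof (rule theI[of _ S])
    show "S' = S" if "\<forall>x y. cinner (T x) y = cinner x (S' y)" for S'
    proof
      show "S' y = S y" for y
        by (rule cinner_right_eqI) (simp flip: that[rule_format] S[rule_format])
    qed
  qed (rule S)
  then show ?thesis by blast
qed

text \<open>Conjugate symmetry moves the adjoint to the second slot, and the resulting value is
  real.\<close>

lemma cinner_cadjoint_self:
  fixes T :: "'a::chilbert_space \<Rightarrow> 'b::chilbert_space"
  assumes "bounded_clinear T"
  shows "cinner (cadjoint T (T x)) x = complex_of_real ((norm (T x))\<^sup>2)"
proof -
  have "cinner (cadjoint T (T x)) x = cnj (cinner (T x) (T x))"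
    by (metis cinner_commute cinner_cadjoint[OF assms])
  then show ?thesis
    by (simp add: cinner_self)
qed

section \<open>The Davis-Wielandt inequality\<close>

theorem theorem2p6:
  fixes T :: "'a::chilbert_space \<Rightarrow> 'a"
  assumes nonzero: "\<exists>x::'a. x \<noteq> 0"
    and T: "bounded_clinear T"
  shows "(davis_wielandt_radius T)\<^sup>2 \<le>
    (SUP \<theta>::real. (numerical_radius (\<lambda>x. exp (\<i> * complex_of_real \<theta>) *\<^sub>C T x + cadjoint T (T x)))\<^sup>2)
      - 2 * crawford_number T * (minimum_norm T)\<^sup>2"
proof -
  interpret T: bounded_linear T
    using T by (simp add: bounded_clinear_def)
  define S where "S \<theta> x = exp (\<i> * complex_of_real \<theta>) *\<^sub>C T x + cadjoint T (T x)" for \<theta> x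
  define R where "R = (SUP \<theta>. (numerical_radius (S \<theta>))\<^sup>2)
      - 2 * crawford_number T * (minimum_norm T)\<^sup>2"
  \<comment> \<open>A unit vector makes the index sets of the suprema and infima over unit vectors
    nonempty.\<close>
  obtain u :: 'a where u: "norm u = 1"
  proof -
    obtain x :: 'a where "x \<noteq> 0" using nonzero by blast
    then show ?thesis using that[of "sgn x"] by (simp add: norm_sgn)
  qed
  then have unit: "{x::'a. norm x = 1} \<noteq> {}" by blast
  obtain K where K: "\<And>x. norm (T x) \<le> norm x * K"
    using T.bounded by blast
  have S_eq: "cinner (S \<theta> x) x =
      exp (\<i> * complex_of_real \<theta>) * cinner (T x) x + complex_of_real ((norm (T x))\<^sup>2)" for \<theta> x
    by (simp only: S_def cinner_add_left cinner_scaleC_left cinner_cadjoint_self[OF T])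
  \<comment> \<open>The bound is uniform in \<open>x\<close> and \<theta>, so it bounds both the
    supremum over unit vectors and the one over \<theta>.\<close>
  have S_bound: "cmod (cinner (S \<theta> x) x) \<le> K + K\<^sup>2" if x: "norm x = 1" for \<theta> x
  proof -
    have Tx: "norm (T x) \<le> K"
      using K[of x] x by simp
    have "cmod (cinner (S \<theta> x) x) \<le> cmod (cinner (T x) x) + (norm (T x))\<^sup>2"
      unfolding S_eq by (rule norm_triangle_le) (simp add: norm_mult norm_power)
    also have "\<dots> \<le> norm (T x) + (norm (T x))\<^sup>2"
      using complex_Cauchy_Schwarz[of "T x" x] x by simp
    also have "\<dots> \<le> K + K\<^sup>2"
      using Tx by (intro add_mono power_mono) auto
    finally show ?thesis .
  qed
  have le_w: "cmod (cinner (S \<theta> x) x) \<le> numerical_radius (S \<theta>)" if "norm x = 1" for \<theta> x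
    unfolding numerical_radius_def
    by (rule cSUP_upper) (use that S_bound in \<open>auto intro!: bdd_aboveI2\<close>)
  have w_le: "(numerical_radius (S \<theta>))\<^sup>2 \<le> (K + K\<^sup>2)\<^sup>2" for \<theta>
  proof (rule power_mono)
    show "numerical_radius (S \<theta>) \<le> K + K\<^sup>2"
      unfolding numerical_radius_def by (rule cSUP_least[OF unit]) (simp add: S_bound)
    \<comment> \<open>The numerical radius dominates a modulus at \<open>u\<close>.\<close>
    show "0 \<le> numerical_radius (S \<theta>)"
      using le_w[OF u, of \<theta>] norm_ge_zero order_trans by blast
  qed
  have w_SUP: "(numerical_radius (S \<theta>))\<^sup>2 \<le> (SUP \<theta>. (numerical_radius (S \<theta>))\<^sup>2)" for \<theta>
    by (rule cSUP_upper) (use w_le in \<open>auto intro!: bdd_aboveI2\<close>)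
  have pointwise: "(cmod (cinner (T x) x))\<^sup>2 + norm (T x) ^ 4 \<le> R" if x: "norm x = 1" for x
  proof -
    define a where "a = cmod (cinner (T x) x)"
    define b where "b = (norm (T x))\<^sup>2"
    have ab: "0 \<le> a" "0 \<le> b" by (simp_all add: a_def b_def)
    have "crawford_number T \<le> a"
      unfolding crawford_number_def a_def
      by (rule cINF_lower) (use x in \<open>auto intro!: bdd_belowI2[where m=0]\<close>)
    moreover have "(minimum_norm T)\<^sup>2 \<le> b"
      unfolding b_def
    proof (rule power_mono)
      show "minimum_norm T \<le> norm (T x)"
        unfolding minimum_norm_def
        by (rule cINF_lower) (use x in \<open>auto intro!: bdd_belowI2[where m=0]\<close>)
      show "0 \<le> minimum_norm T"
        unfolding minimum_norm_def by (rule cINF_greatest[OF unit]) simp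
    qed
    ultimately have cm: "crawford_number T * (minimum_norm T)\<^sup>2 \<le> a * b"
      using ab by (intro mult_mono) auto
    \<comment> \<open>The angle depends on \<open>x\<close>, which is why the final bound takes the
      supremum over all \<theta>.\<close>
    obtain \<theta> where "exp (\<i> * complex_of_real \<theta>) * cinner (T x) x = complex_of_real a"
      using rotate_to_cmod unfolding a_def by blast
    then have "cinner (S \<theta> x) x = complex_of_real (a + b)"
      by (simp add: S_eq b_def)
    then have "a + b \<le> numerical_radius (S \<theta>)"
      using le_w[OF x, of \<theta>] ab by (simp only: norm_of_real)
    then have "(a + b)\<^sup>2 \<le> (numerical_radius (S \<theta>))\<^sup>2"
      using ab by (intro power_mono) auto
    also have "\<dots> \<le> (SUP \<theta>. (numerical_radius (S \<theta>))\<^sup>2)"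
      by (rule w_SUP)
    finally have "a\<^sup>2 + b\<^sup>2 \<le> R"
      using cm by (simp add: R_def power2_sum)
    then show ?thesis
      by (simp add: a_def b_def flip: power_mult)
  qed
  \<comment> \<open>Nonnegativity of \<open>R\<close> turns \<open>(sqrt R)\<^sup>2\<close> into
    \<open>R\<close> at the end.\<close>
  have "0 \<le> (cmod (cinner (T u) u))\<^sup>2 + norm (T u) ^ 4" by simp
  also have "\<dots> \<le> R" using pointwise[OF u] .
  finally have "0 \<le> R" .
  \<comment> \<open>The value at \<open>u\<close> shows that the radius is nonnegative, so its upper
    bound may be squared.\<close>
  have "sqrt ((cmod (cinner (T u) u))\<^sup>2 + norm (T u) ^ 4) \<le> davis_wielandt_radius T"
    unfolding davis_wielandt_radius_def
    by (rule cSUP_upper) (use u pointwise in \<open>auto intro!: bdd_aboveI2[where M="sqrt R"]\<close>)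
  then have "0 \<le> davis_wielandt_radius T"
    by (rule order_trans[rotated]) simp
  moreover have "davis_wielandt_radius T \<le> sqrt R"
    unfolding davis_wielandt_radius_def by (rule cSUP_least[OF unit]) (simp add: pointwise)
  ultimately have "(davis_wielandt_radius T)\<^sup>2 \<le> (sqrt R)\<^sup>2"
    by (intro power_mono)
  then show ?thesis
    using \<open>0 \<le> R\<close> by (simp add: R_def S_def[abs_def])
qed

end
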